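(* There is an absolute constant $C$ such that the following holds. Let $0<\delta<1$ with $1/\delta\in\mathbb{N}$, let $z\in\mathbb{Z}^2$, $\rho\in\Gamma$, let $1<p<\infty$ with $p'\in\mathbb{N}$, where $1/p+1/p'=1$, and let $w$ be a weight in $\mathbb{R}^2$. If $w\in A^S_{p,\rho,z}$, i.e. $[w]_{A^S_{p,\rho,z}}<\infty$, then for every $f$ $$\|\widetilde{M}_{\rho,\delta}f\|_{L^p(Q_z,w)}\le C\,\delta^{-\frac{5}{4p}}\,[w]_{A^S_{p,\rho,z}}^{\frac1p}\,\|f\|_{L^p(7Q_z,w)}.$$
   Context: A weight is a non-negative locally integrable function on $\mathbb{R}^2$; $L^p(E,w)=L^p(E,w\,dx)$; $|E|$ is Lebesgue measure. Negative powers of $w$ are $+\infty$ where $w=0$, and $0\cdot\infty=0$. For a square $Q$, $CQ$ denotes the square concentric with $Q$ with sidelength $C$ times that of $Q$. Fix $\delta\in(0,1)$ with $1/\delta$ an integer and set $u=1/\delta^2$. For $z\in\mathbb{Z}^2$, $Q_z$ is the axis-parallel square of sidelength $1$ with lower left vertex $z$. It is divided by the grid $\delta\mathbb{Z}^2$ into $u$ squares $Q_z(1),\dots,Q_z(u)$ of sidelength $\delta$ (partitioning $Q_z$), with centers $x_1,\dots,x_u$; $Q_z^*=\{x_1,\dots,x_u\}$. For $x\in Q_z$, $x^*$ is the center of the square $Q_z(i)$ containing $x$. $\Gamma$ is the family of all functions $\rho:Q_z^*\to[1,2]\cap\delta\mathbb{Z}$. $S(x,r)$ denotes the $1$-skeleton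 (boundary, union of four sides) of the axis-parallel square with center $x$ and sidelength $2r$. Selection of sides: for each $z$ and each $\rho\in\Gamma$, fix a choice $\Phi$ of one side $l^\rho_{i,z}$ of each $S(x_i,\rho(x_i))$, $i=1,\dots,u$, such that every line parallel to a coordinate axis contains at most $C_0\,u^{5/8}$ of the chosen sides, where $C_0$ is an absolute constant (such a choice is known to exist). $\ell^\rho_{i,z}$ denotes the $\delta$-neighborhood of $l^\rho_{i,z}$. The operator $\widetilde{M}_{\rho,\delta}$ is defined for locally integrable $f$ and $x\in Q_z$ by $$\widetilde{M}_{\rho,\delta}f(x)=\frac{1}{|\ell_{x,\delta}|}\int_{\ell_{x,\delta}}f(y)\,dy,$$ where $\ell_{x,\delta}$ is the $\delta$-neighborhood of the chosen side of $S(x^*,\rho(x^* ))$, i.e. $\ell_{x,\delta}=\ell^\rho_{i,z}$ when $x\in Q_z(i)$. Finally $$[w]_{A^S_{p,\rho,z}}=\max_{1\le i\le u}\left(\frac{1}{|\ell^\rho_{i,z}|}\int_{Q_z(i)}w\right)\left(\frac{1}{|\ell^\rho_{i,z}|}\int_{\ell^\rho_{i,z}}w^{-p'/p}\right)^{p-1}.$$ *)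

theory Defs
  imports "HOL-Analysis.Analysis"
begin

section \<open>Powers of extended non-negative reals, weights and weighted norms\<close>

text \<open>Real powers on $[0,\infty]$. A negative power of $0$ is $\infty$, and positive powers of
  $\infty$ are $\infty$. The product on \<^typ>\<open>ennreal\<close> already satisfies $0\cdot\infty=0$.\<close>

definition epowr :: "ennreal \<Rightarrow> real \<Rightarrow> ennreal" where
  "epowr a s =
     (if s = 0 then 1
      else if a = 0 then (if s < 0 then \<infinity> else 0)
      else if a = \<infinity> then (if s < 0 then 0 else \<infinity>)
      else ennreal (enn2real a powr s))"

definition locally_integrable :: "(real^2 \<Rightarrow> 'b::euclidean_space) \<Rightarrow> bool" where
  "locally_integrable f \<longleftrightarrow> (\<forall>K. compact K \<longrightarrow> f absolutely_integrable_on K)"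

definition weight :: "(real^2 \<Rightarrow> real) \<Rightarrow> bool" where
  "weight w \<longleftrightarrow> (\<forall>x. 0 \<le> w x) \<and> locally_integrable w"

definition Lp_norm :: "real \<Rightarrow> (real^2) set \<Rightarrow> (real^2 \<Rightarrow> real) \<Rightarrow> (real^2 \<Rightarrow> complex) \<Rightarrow> ennreal" where
  "Lp_norm p E w f = epowr (\<integral>\<^sup>+x\<in>E. ennreal (norm (f x) powr p * w x) \<partial>lebesgue) (1/p)"


section \<open>Squares and the grid\<close>

text \<open>Squares are half-open, so that the unit squares and the grid squares really are partitions.\<close>

definition square :: "real^2 \<Rightarrow> real \<Rightarrow> (real^2) set" where
  "square c s = {x. \<forall>i. c$i - s/2 \<le> x$i \<and> x$i < c$i + s/2}"

definition unit_centre :: "int^2 \<Rightarrow> real^2" where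
  "unit_centre z = (\<chi> i. of_int (z$i) + 1/2)"

abbreviation unit_square :: "int^2 \<Rightarrow> (real^2) set" where
  "unit_square z \<equiv> square (unit_centre z) 1"

text \<open>The set $Q_z^*$. The grid squares $Q_z(i)$ are indexed by their centres: if $c\in Q_z^*$ is
  the centre $x_i$, then $Q_z(i)$ is \<^term>\<open>square c \<delta>\<close>.\<close>

definition grid_centres :: "real \<Rightarrow> int^2 \<Rightarrow> (real^2) set" where
  "grid_centres \<delta> z = {c \<in> unit_square z. \<exists>k::int^2. c = (\<chi> i. \<delta> * (of_int (k$i) + 1/2))}"

text \<open>The point $x^*$.\<close>

definition cell_centre :: "real \<Rightarrow> int^2 \<Rightarrow> real^2 \<Rightarrow> real^2" where
  "cell_centre \<delta> z x = (THE c. c \<in> grid_centres \<delta> z \<and> x \<in> square c \<delta>)"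

text \<open>The family $\Gamma$ (for the square $Q_z$).\<close>

definition radius_functions :: "real \<Rightarrow> int^2 \<Rightarrow> (real^2 \<Rightarrow> real) set" where
  "radius_functions \<delta> z = grid_centres \<delta> z \<rightarrow>\<^sub>E {r. 1 \<le> r \<and> r \<le> 2 \<and> (\<exists>k::int. r = \<delta> * of_int k)}"


section \<open>Selection of sides\<close>

text \<open>The four sides of the $1$-skeleton $S(c,r)$.\<close>

definition sides :: "real^2 \<Rightarrow> real \<Rightarrow> (real^2) set set" where
  "sides c r = {{y. y$i = c$i + \<sigma> * r \<and> (\<forall>j. \<bar>y$j - c$j\<bar> \<le> r)} | i \<sigma>. \<sigma> \<in> {-1, 1}}"

text \<open>\<^term>\<open>\<Phi> z \<rho> c\<close> is the side chosen for the centre $c$. The bound on the number of sides in a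
  line counts centres; sides chosen at different centres are different, because
  \<^term>\<open>\<rho> c \<ge> 1\<close> and the centres lie in one unit square.\<close>

definition admissible_selection ::
    "real \<Rightarrow> real \<Rightarrow> (int^2 \<Rightarrow> (real^2 \<Rightarrow> real) \<Rightarrow> real^2 \<Rightarrow> (real^2) set) \<Rightarrow> bool" where
  "admissible_selection C0 \<delta> \<Phi> \<longleftrightarrow>
     (\<forall>z. \<forall>\<rho> \<in> radius_functions \<delta> z.
        (\<forall>c \<in> grid_centres \<delta> z. \<Phi> z \<rho> c \<in> sides c (\<rho> c)) \<and>
        (\<forall>(i::2) a. real (card {c \<in> grid_centres \<delta> z. \<Phi> z \<rho> c \<subseteq> {y. y$i = a}})
                      \<le> C0 * (1/\<delta>\<^sup>2) powr (5/8)))"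

definition nbhd :: "real \<Rightarrow> (real^2) set \<Rightarrow> (real^2) set" where
  "nbhd \<delta> l = (\<Union>x\<in>l. ball x \<delta>)"


section \<open>The maximal operator and the weight constant\<close>

text \<open>Both take the map $l$ sending each centre to its chosen side, that is
  \<^term>\<open>l = \<Phi> z \<rho>\<close>. The operator is meant to be evaluated on $Q_z$ only.\<close>

definition M_op :: "real \<Rightarrow> int^2 \<Rightarrow> (real^2 \<Rightarrow> (real^2) set) \<Rightarrow> (real^2 \<Rightarrow> complex) \<Rightarrow> real^2 \<Rightarrow> complex" where
  "M_op \<delta> z l f x =
     (let L = nbhd \<delta> (l (cell_centre \<delta> z x))
      in (1 / measure lebesgue L) *\<^sub>R (LINT y:L|lebesgue. f y))"

definition A_const :: "real \<Rightarrow> int^2 \<Rightarrow> (real^2 \<Rightarrow> (real^2) set) \<Rightarrow> real \<Rightarrow> real \<Rightarrow> (real^2 \<Rightarrow> real) \<Rightarrow> ennreal" where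
  "A_const \<delta> z l p p' w =
     Max ((\<lambda>c. let L = nbhd \<delta> (l c) in
             ((\<integral>\<^sup>+x\<in>square c \<delta>. ennreal (w x) \<partial>lebesgue) / emeasure lebesgue L) *
             epowr ((\<integral>\<^sup>+x\<in>L. epowr (ennreal (w x)) (-(p'/p)) \<partial>lebesgue) / emeasure lebesgue L) (p - 1))
          ` grid_centres \<delta> z)"


section \<open>Sanity checks\<close>

lemma skeleton_eq_Union_sides:
  fixes c :: "real^2"
  shows "frontier (cbox (c - (\<chi> i. r)) (c + (\<chi> i. r))) = \<Union>(sides c r)"
proof -
  have *: "y \<in> cbox (c - (\<chi> i. r)) (c + (\<chi> i. r)) - box (c - (\<chi> i. r)) (c + (\<chi> i. r)) \<longleftrightarrow>
        (\<exists>i \<sigma>. \<sigma> \<in> {-1,1} \<and> y$i = c$i + \<sigma> * r \<and> (\<forall>j. \<bar>y$j - c$j\<bar> \<le> r))" for y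
  proof -
    have 1: "y \<in> cbox (c - (\<chi> i. r)) (c + (\<chi> i. r)) \<longleftrightarrow> (\<forall>j. \<bar>y$j - c$j\<bar> \<le> r)"
      unfolding mem_box_cart by (intro all_cong1) (simp add: abs_le_iff, linarith)
    have 2: "y \<in> box (c - (\<chi> i. r)) (c + (\<chi> i. r)) \<longleftrightarrow> (\<forall>j. \<bar>y$j - c$j\<bar> < r)"
      unfolding mem_box_cart by (intro all_cong1) (simp add: abs_less_iff, linarith)
    have 3: "\<not> \<bar>y$i - c$i\<bar> < r \<longleftrightarrow> (\<exists>\<sigma>. \<sigma> \<in> {-1,1} \<and> y$i = c$i + \<sigma> * r)"
      if "\<bar>y$i - c$i\<bar> \<le> r" for i
      using that by (auto simp: abs_if split: if_splits)
    show ?thesis unfolding Diff_iff 1 2 using 3 by blast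
  qed
  show ?thesis unfolding frontier_cbox sides_def set_eq_iff * by blast
qed

lemma unit_square_lower_left:
  "unit_square z = {x. \<forall>i. of_int (z$i) \<le> x$i \<and> x$i < of_int (z$i) + 1}"
  by (simp add: square_def unit_centre_def add.commute)

lemma finite_grid_centres:
  assumes "0 < \<delta>"
  shows "finite (grid_centres \<delta> z)"
proof -
  define A where "A i = {\<lfloor>of_int (z$i) / \<delta>\<rfloor> - 1 .. \<lceil>(of_int (z$i) + 1) / \<delta>\<rceil>}" for i
  have A: "k$i \<in> A i" if "(\<chi> i. \<delta> * (of_int (k$i) + 1/2)) \<in> unit_square z" for k :: "int^2" and i
  proof -
    have 1: "of_int (z$i) \<le> \<delta> * (of_int (k$i) + 1/2)" "\<delta> * (of_int (k$i) + 1/2) < of_int (z$i) + 1"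
      using that by (auto simp: unit_square_lower_left)
    have "of_int (z$i) / \<delta> \<le> of_int (k$i) + 1/2" "of_int (k$i) + 1/2 < (of_int (z$i) + 1) / \<delta>"
      using 1 assms by (simp_all add: field_simps)
    then show ?thesis unfolding A_def by simp linarith
  qed
  have "grid_centres \<delta> z \<subseteq>
      (\<lambda>(a,b). vector [\<delta> * (of_int a + 1/2), \<delta> * (of_int b + 1/2)]) ` (A 1 \<times> A 2)"
  proof (intro subsetI)
    fix c assume "c \<in> grid_centres \<delta> z"
    then obtain k :: "int^2" where k: "c = (\<chi> i. \<delta> * (of_int (k$i) + 1/2))" "c \<in> unit_square z"
      by (auto simp: grid_centres_def)
    then have "c = (\<lambda>(a,b). vector [\<delta> * (of_int a + 1/2), \<delta> * (of_int b + 1/2)]) (k$1, k$2)"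
      by (simp add: vec_eq_iff forall_2)
    moreover have "(k$1, k$2) \<in> A 1 \<times> A 2"
      using A k by simp
    ultimately show "c \<in> (\<lambda>(a,b). vector [\<delta> * (of_int a + 1/2), \<delta> * (of_int b + 1/2)]) ` (A 1 \<times> A 2)"
      by (rule image_eqI)
  qed
  then show ?thesis by (rule finite_subset) (auto simp: A_def)
qed

lemma ex1_cell:
  assumes "0 < \<delta>" "1/\<delta> \<in> \<nat>" "x \<in> unit_square z"
  shows "\<exists>!c. c \<in> grid_centres \<delta> z \<and> x \<in> square c \<delta>"
proof -
  obtain n where "1/\<delta> = real n" using assms(2) Nats_cases by metis
  then have n: "\<delta> * real n = 1" using assms(1) by (simp add: field_simps)
  have sq: "x \<in> square (\<chi> i. \<delta> * (of_int (k$i) + 1/2)) \<delta> \<longleftrightarrow> (\<forall>i. k$i = \<lfloor>x$i / \<delta>\<rfloor>)" for k :: "int^2"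
  proof -
    have "k$i = \<lfloor>x$i / \<delta>\<rfloor> \<longleftrightarrow> of_int (k$i) * \<delta> \<le> x$i \<and> x$i < (of_int (k$i) + 1) * \<delta>" for i
      using assms(1) floor_eq_iff[of "x$i / \<delta>" "k$i"]
      by (auto simp: pos_le_divide_eq pos_divide_less_eq eq_commute)
    then show ?thesis by (simp add: square_def algebra_simps)
  qed
  define c where "c = (\<chi> i::2. \<delta> * (of_int ((\<chi> i. \<lfloor>x$i / \<delta>\<rfloor>) $ i) + 1/2))"
  have "of_int (z$i) \<le> c$i \<and> c$i < of_int (z$i) + 1" for i
  proof -
    let ?m = "\<lfloor>x$i / \<delta>\<rfloor>"
    have x: "of_int (z$i) \<le> x$i" "x$i < of_int (z$i) + 1"
      using assms(3) by (auto simp: unit_square_lower_left)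
    have inv: "x$i / \<delta> = x$i * real n" using n assms(1) by (simp add: field_simps)
    have npos: "real n > 0" using n assms(1) by (metis mult_zero_right of_nat_0_less_iff of_nat_0 gr0I zero_neq_one)
    have "of_int (z$i * int n) \<le> x$i / \<delta>" "x$i / \<delta> < of_int ((z$i + 1) * int n)"
      using x npos by (simp_all add: inv)
    then have "z$i * int n \<le> ?m" "?m < (z$i + 1) * int n"
      by (simp_all only: le_floor_iff floor_less_iff)
    then have "z$i * int n \<le> ?m" "?m + 1 \<le> (z$i + 1) * int n"
      by simp_all
    then have "of_int (z$i * int n) \<le> (of_int ?m :: real)" "of_int ?m + 1 \<le> (of_int ((z$i + 1) * int n) :: real)"
      by linarith+
    then have "\<delta> * of_int (z$i * int n) \<le> \<delta> * (of_int ?m :: real)"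
      "\<delta> * (of_int ?m + 1) \<le> \<delta> * (of_int ((z$i + 1) * int n) :: real)"
      using assms(1) by (simp_all only: mult_left_mono less_imp_le)
    moreover have sc: "\<delta> * of_int (a * int n) = of_int a" for a
      using n by (simp add: mult.left_commute)
    ultimately have "of_int (z$i) \<le> \<delta> * (of_int ?m :: real)"
      "\<delta> * (of_int ?m + 1) \<le> (of_int (z$i + 1) :: real)"
      unfolding sc by simp_all
    moreover have "c$i = \<delta> * of_int ?m + \<delta> / 2"
      by (simp add: c_def algebra_simps)
    ultimately show ?thesis
      using assms(1) by (simp add: distrib_left)
  qed
  then have "c \<in> grid_centres \<delta> z"
    unfolding grid_centres_def unit_square_lower_left c_def by blast
  moreover have "x \<in> square c \<delta>" unfolding c_def sq by simp
  moreover have "c' = c" if c': "c' \<in> grid_centres \<delta> z" "x \<in> square c' \<delta>" for c'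
  proof -
    obtain k :: "int^2" where k: "c' = (\<chi> i. \<delta> * (of_int (k$i) + 1/2))"
      using c'(1) unfolding grid_centres_def by blast
    then have "\<forall>i. k$i = \<lfloor>x$i / \<delta>\<rfloor>" using c'(2) sq by simp
    then show ?thesis by (simp add: k c_def)
  qed
  ultimately show ?thesis by blast
qed

end

(*
On a grid cell the averaging operator is constant, and Hoelder's inequality with respect to w bounds
its contribution to the p-th power of the norm by the A-constant times the integral of |f|^p w over
the neighbourhood of the chosen side. Since the sides lie on lines of a grid of mesh delta, every
point belongs to the neighbourhoods of sides from at most four lines, hence to at most
4 C0 delta^(-5/4) neighbourhoods; summing over the cells gives the estimate with C = max 1 (4 C0).
*)
theory Submission
  imports Defs
begin

section \<open>Positive powers on the extended half-line\<close>

lemma epowr_ennreal_pos: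
  assumes "0 < x"
  shows "epowr (ennreal x) s = ennreal (x powr s)"
  using assms by (auto simp: epowr_def)

lemma epowr_zero [simp]: "0 < s \<Longrightarrow> epowr 0 s = 0"
  by (simp add: epowr_def)

lemma epowr_top [simp]: "0 < s \<Longrightarrow> epowr top s = top"
  by (simp add: epowr_def)

lemma epowr_ennreal:
  assumes "0 \<le> x" "0 < s"
  shows "epowr (ennreal x) s = ennreal (x powr s)"
  using assms by (cases "x = 0") (auto simp: epowr_ennreal_pos)

lemma epowr_mono:
  assumes "a \<le> b" "0 < s"
  shows "epowr a s \<le> epowr b s"
  using assms by (cases a; cases b) (auto simp: epowr_ennreal powr_mono2 top_unique)

text \<open>For \<open>0 < s\<close> the power fixes 0 and \<open>top\<close>, so both sides obey
  the convention \<open>0 * top = 0\<close>; for the remaining values this is multiplicativity of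
  \<open>powr\<close>.\<close>

lemma epowr_mult:
  assumes "0 < s"
  shows "epowr (a * b) s = epowr a s * epowr b s"
proof (cases "a = 0 \<or> b = 0")
  case True
  with assms show ?thesis by auto
next
  case False
  then show ?thesis
    using assms
    by (cases a; cases b)
      (auto simp: epowr_ennreal powr_mult ennreal_mult_top ennreal_top_mult simp flip: ennreal_mult)
qed

section \<open>A weighted Hoelder inequality\<close>

text \<open>Young's inequality with exponents \<open>p\<close> and \<open>p / (p - 1)\<close> for
  the product of \<open>t / s\<close> and \<open>a powr (p - 1)\<close>, multiplied by
  \<open>p * s\<close>. The choice \<open>s = v powr (- (1 / (p - 1)))\<close> makes
  \<open>s powr (1 - p)\<close> equal to \<open>v\<close>, so the weight appears. The parameter
  \<open>a\<close> stays free for a later optimisation.\<close>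

lemma weighted_Young:
  fixes t v a p :: real
  assumes "1 < p" "0 < v" "0 \<le> t" "0 < a"
  shows "p * a powr (p - 1) * t \<le> t powr p * v + (p - 1) * a powr p * v powr (- (1 / (p - 1)))"
proof -
  define s where "s = v powr (- (1 / (p - 1)))"
  have s: "0 < s" using assms by (simp add: s_def)
  have "t / s * a powr (p - 1) \<le> (t / s) powr p / p + (a powr (p - 1)) powr (p / (p - 1)) / (p / (p - 1))"
    using assms s by (intro Youngs_inequality) (auto simp: field_simps)
  also have "(a powr (p - 1)) powr (p / (p - 1)) = a powr p"
    using assms by (simp add: powr_powr)
  finally have "t * (p * a powr (p - 1)) \<le> s * ((t / s) powr p) + (p - 1) * a powr p * s"
    using assms s by (simp add: field_simps)
  also have "s * ((t / s) powr p) = t powr p * s powr (1 - p)"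
    using assms s by (simp add: powr_divide powr_diff)
  also have "s powr (1 - p) = v"
  proof -
    have "- (1 / (p - 1)) * (1 - p) = 1" using assms by (simp add: field_simps)
    with assms show ?thesis by (simp add: s_def powr_powr del: mult_minus_left)
  qed
  finally show ?thesis by (simp add: s_def mult_ac)
qed

lemma epowr_borel_measurable [measurable]: "(\<lambda>x. epowr x s) \<in> borel_measurable borel"
  unfolding epowr_def by measurable

text \<open>The assumption on \<^term>\<open>a\<close> replaces division by integrals that may vanish: if the integral of
  $|f|^p w$ is $\phi$, the usual inequality is the case $a=(\phi/s)^{1/p}$, or $a\to 0$ if $\phi=0$.\<close>

lemma weighted_Hoelder:
  fixes f :: "'a \<Rightarrow> 'b::euclidean_space" and w :: "'a \<Rightarrow> real"
  assumes [measurable]: "f \<in> borel_measurable M" "w \<in> borel_measurable M" "L \<in> sets M"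
    and p: "1 < p" and w: "\<And>x. 0 \<le> w x" and "0 \<le> s" "0 < a"
    and S: "(\<integral>\<^sup>+x\<in>L. epowr (ennreal (w x)) (- (1 / (p - 1))) \<partial>M) = ennreal s"
    and F: "(\<integral>\<^sup>+x\<in>L. ennreal (norm (f x) powr p * w x) \<partial>M) \<le> ennreal (a powr p * s)"
  shows "(\<integral>\<^sup>+x\<in>L. ennreal (norm (f x)) \<partial>M) \<le> ennreal (a * s)"
proof -
  let ?I = "\<integral>\<^sup>+x\<in>L. ennreal (norm (f x)) \<partial>M"
  let ?g = "\<lambda>x. ennreal (norm (f x) powr p * w x)"
  let ?h = "\<lambda>x. epowr (ennreal (w x)) (- (1 / (p - 1)))"
  \<comment> \<open>Where \<open>w\<close> vanishes the dual weight is infinite and has a positive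
    coefficient, so the right side is \<open>top\<close>; elsewhere this is
    \<open>weighted_Young\<close>.\<close>
  have pointwise: "ennreal (p * a powr (p - 1)) * ennreal (norm (f x))
      \<le> ?g x + ennreal ((p - 1) * a powr p) * ?h x" for x
  proof (cases "w x = 0")
    case True
    then have "?h x = \<infinity>" using p by (simp add: epowr_def)
    with p \<open>0 < a\<close> show ?thesis by (simp add: ennreal_mult_top)
  next
    case False
    then have "0 < w x" using w[of x] by simp
    with weighted_Young[OF p this _ \<open>0 < a\<close>, of "norm (f x)"] p w[of x] show ?thesis
      by (simp add: epowr_ennreal_pos flip: ennreal_mult ennreal_plus)
  qed
  have "ennreal (p * a powr (p - 1)) * ?I
      = (\<integral>\<^sup>+x. ennreal (p * a powr (p - 1)) * ennreal (norm (f x)) * indicator L x \<partial>M)"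
    by (subst nn_integral_cmult[symmetric]) (auto simp: mult_ac)
  also have "\<dots> \<le> (\<integral>\<^sup>+x. ?g x * indicator L x + ennreal ((p - 1) * a powr p) * (?h x * indicator L x) \<partial>M)"
    using pointwise by (intro nn_integral_mono) (auto simp: indicator_def)
  also have "\<dots> = (\<integral>\<^sup>+x\<in>L. ?g x \<partial>M) + ennreal ((p - 1) * a powr p) * ennreal s"
    unfolding S[symmetric] by (subst nn_integral_add, measurable) (subst nn_integral_cmult, auto)
  also have "\<dots> \<le> ennreal (a powr p * s) + ennreal ((p - 1) * a powr p) * ennreal s"
    by (intro add_right_mono F)
  \<comment> \<open>The two terms add up to \<open>p * a powr p * s\<close>; the positive finite
    factor \<open>p * a powr (p - 1)\<close> then cancels.\<close>
  also have "\<dots> = ennreal (p * a powr (p - 1)) * ennreal (a * s)"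
  proof -
    have "a powr p * s + (p - 1) * a powr p * s = p * a powr (p - 1) * (a * s)"
      using \<open>0 < a\<close> by (simp add: powr_diff field_simps)
    then show ?thesis
      using p \<open>0 \<le> s\<close> \<open>0 < a\<close> by (simp flip: ennreal_mult ennreal_plus)
  qed
  finally show ?thesis
    using p \<open>0 < a\<close> by (subst (asm) ennreal_mult_le_mult_iff) auto
qed

text \<open>If \<open>f\<close> is not integrable on \<open>L\<close>, its integral has the default
  value 0, and \<open>0 \<le> b\<close> settles that case.\<close>

lemma norm_set_integral_le:
  fixes f :: "'a \<Rightarrow> 'b::euclidean_space"
  assumes "(\<integral>\<^sup>+x\<in>L. ennreal (norm (f x)) \<partial>M) \<le> ennreal b" "0 \<le> b"
  shows "norm (LINT x:L|M. f x) \<le> b"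
proof (cases "set_integrable M L f")
  case True
  then have "ennreal (norm (LINT x:L|M. f x)) \<le> (\<integral>\<^sup>+x. ennreal (norm (indicator L x *\<^sub>R f x)) \<partial>M)"
    unfolding set_lebesgue_integral_def set_integrable_def by (rule integral_norm_bound_ennreal)
  also have "\<dots> = (\<integral>\<^sup>+x\<in>L. ennreal (norm (f x)) \<partial>M)"
    by (intro nn_integral_cong) (auto simp: indicator_def)
  finally show ?thesis using assms by (meson ennreal_le_iff order_trans)
next
  case False
  with assms show ?thesis
    by (simp add: set_lebesgue_integral_def set_integrable_def not_integrable_integral_eq)
qed

lemma norm_integral_powr_le:
  fixes f :: "'a \<Rightarrow> 'b::euclidean_space" and w :: "'a \<Rightarrow> real"
  assumes [measurable]: "f \<in> borel_measurable M" "w \<in> borel_measurable M" "L \<in> sets M"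
    and p: "1 < p" and w: "\<And>x. 0 \<le> w x" and "0 < s" "0 \<le> \<phi>"
    and S: "(\<integral>\<^sup>+x\<in>L. epowr (ennreal (w x)) (- (1 / (p - 1))) \<partial>M) = ennreal s"
    and F: "(\<integral>\<^sup>+x\<in>L. ennreal (norm (f x) powr p * w x) \<partial>M) = ennreal \<phi>"
  shows "norm (LINT x:L|M. f x) powr p \<le> \<phi> * s powr (p - 1)"
proof -
  let ?b = "norm (LINT x:L|M. f x)"
  have *: "?b \<le> a * s" if "0 < a" "\<phi> \<le> a powr p * s" for a
    using that \<open>0 < s\<close>
    by (intro norm_set_integral_le weighted_Hoelder[OF assms(1-3) p w _ _ S]) (auto simp: F ennreal_leI)
  show ?thesis
  proof (cases "\<phi> = 0")
    case True
    \<comment> \<open>Here every positive \<open>a\<close> is admissible, and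
      \<open>a = e / s\<close> gives the bound \<open>e\<close>.\<close>
    have "?b \<le> 0 + e" if "0 < e" for e
      using *[of "e / s"] that \<open>0 < s\<close> True by simp
    then have "?b \<le> 0" by (rule field_le_epsilon)
    with True show ?thesis by simp
  next
    case False
    \<comment> \<open>The solution of \<open>a powr p * s = \<phi>\<close>, the smallest admissible
      parameter.\<close>
    define a where "a = (\<phi> / s) powr (1 / p)"
    have a: "0 < a" "a powr p = \<phi> / s"
      using False \<open>0 < s\<close> \<open>0 \<le> \<phi>\<close> p by (auto simp: a_def powr_powr)
    then have "?b \<le> a * s" using \<open>0 < s\<close> by (intro *) auto
    then have "?b powr p \<le> (a * s) powr p" using p by (intro powr_mono2) auto
    also have "\<dots> = \<phi> * s powr (p - 1)"
      using a \<open>0 < s\<close> by (simp add: powr_mult powr_diff)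
    finally show ?thesis .
  qed
qed

section \<open>Locally integrable functions\<close>

text \<open>The truncations of \<open>f\<close> to the balls of radius \<open>n\<close> are
  measurable and at each point eventually equal to \<open>f\<close>.\<close>

lemma locally_integrable_measurable:
  fixes f :: "real^2 \<Rightarrow> 'b::euclidean_space"
  assumes "locally_integrable f"
  shows "f \<in> borel_measurable lebesgue"
proof (rule borel_measurable_LIMSEQ_metric)
  fix n :: nat
  have "f absolutely_integrable_on cball 0 (real n)"
    using assms by (auto simp: locally_integrable_def)
  then show "(\<lambda>x. indicator (cball 0 (real n)) x *\<^sub>R f x) \<in> borel_measurable lebesgue"
    by (auto simp: set_integrable_def)
next
  fix x :: "real^2"
  have "\<forall>\<^sub>F n in sequentially. indicator (cball 0 (real n)) x *\<^sub>R f x = f x"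
    using eventually_ge_at_top[of "nat \<lceil>norm x\<rceil>"]
    by eventually_elim (auto simp: indicator_def)
  then show "(\<lambda>n. indicator (cball 0 (real n)) x *\<^sub>R f x) \<longlonglongrightarrow> f x"
    by (rule tendsto_eventually)
qed

section \<open>Squares and neighbourhoods of sides\<close>

lemma square_measurable [measurable]: "square c s \<in> sets lebesgue"
proof -
  have "square c s = (\<Inter>i. {x. c$i - s/2 \<le> x$i} \<inter> {x. x$i < c$i + s/2})"
    by (auto simp: square_def)
  also have "\<dots> \<in> sets borel" by measurable
  finally show ?thesis by simp
qed

lemma open_nbhd: "open (nbhd \<delta> l)"
  by (auto simp: nbhd_def)

text \<open>The factor 7 comes from \<open>1/2 + 2 + 1 = 7/2\<close> in each coordinate: offset of
  the centre, radius, width of the neighbourhood.\<close>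

lemma nbhd_subset_square:
  assumes "c \<in> unit_square z" "r \<le> 2" "\<delta> < 1" "l \<in> sides c r"
  shows "nbhd \<delta> l \<subseteq> square (unit_centre z) 7"
proof
  fix y assume "y \<in> nbhd \<delta> l"
  then obtain x where x: "x \<in> l" "dist x y < \<delta>" by (auto simp: nbhd_def)
  have "\<bar>y$i - unit_centre z $ i\<bar> < 7/2" for i
  proof -
    have "\<bar>x$i - c$i\<bar> \<le> r" using x(1) assms(4) by (auto simp: sides_def)
    moreover have "\<bar>x$i - y$i\<bar> < 1"
      using dist_vec_nth_le[of x i y] x(2) assms(3) by (simp add: dist_real_def)
    moreover have "\<bar>c$i - unit_centre z $ i\<bar> \<le> 1/2"
    proof -
      have "unit_centre z $ i - 1/2 \<le> c$i" "c$i < unit_centre z $ i + 1/2"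
        using assms(1) by (auto simp: square_def)
      then show ?thesis by linarith
    qed
    ultimately show ?thesis using assms(2) by linarith
  qed
  then have "unit_centre z $ i - 7/2 \<le> y$i \<and> y$i < unit_centre z $ i + 7/2" for i
    by (smt (verit))
  then show "y \<in> square (unit_centre z) 7" unfolding square_def by blast
qed

lemma bounded_nbhd_side:
  assumes "l \<in> sides c r"
  shows "bounded (nbhd \<delta> l)"
proof -
  have "l \<subseteq> cbox (c - (\<chi> i. r)) (c + (\<chi> i. r))"
  proof
    fix x assume "x \<in> l"
    then have "\<bar>x$j - c$j\<bar> \<le> r" for j using assms by (auto simp: sides_def)
    then have "c$j - r \<le> x$j \<and> x$j \<le> c$j + r" for j by (smt (verit))
    then show "x \<in> cbox (c - (\<chi> i. r)) (c + (\<chi> i. r))" by (simp add: mem_box_cart)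
  qed
  then have "bounded l" using bounded_cbox bounded_subset by blast
  then obtain e where e: "\<And>x. x \<in> l \<Longrightarrow> norm x \<le> e" by (auto simp: bounded_iff)
  have "norm y \<le> e + \<delta>" if y: "y \<in> nbhd \<delta> l" for y
  proof -
    obtain x where "x \<in> l" "dist x y < \<delta>" using y by (auto simp: nbhd_def)
    then show ?thesis using e[of x] norm_triangle_sub[of y x] by (simp add: dist_norm norm_minus_commute)
  qed
  then show ?thesis unfolding bounded_iff by blast
qed

text \<open>A nonempty open set is not negligible, and boundedness excludes infinite measure, for
  which \<open>measure\<close> would return 0.\<close>

lemma measure_nbhd_side_pos:
  assumes "l \<in> sides c r" "0 \<le> r" "0 < \<delta>"
  shows "0 < measure lebesgue (nbhd \<delta> l)"
proof -
  obtain i \<sigma> where l: "l = {y. y$i = c$i + \<sigma> * r \<and> (\<forall>j. \<bar>y$j - c$j\<bar> \<le> r)}" "\<sigma> \<in> {-1, 1}"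
    using assms(1) by (auto simp: sides_def)
  \<comment> \<open>The midpoint of the side.\<close>
  then have "(\<chi> j. if j = i then c$i + \<sigma> * r else c$j) \<in> l"
    using assms(2) by auto
  then have "nbhd \<delta> l \<noteq> {}" using assms(3) by (auto simp: nbhd_def)
  then have "\<not> negligible (nbhd \<delta> l)"
    using open_nbhd open_not_negligible by blast
  moreover have "nbhd \<delta> l \<in> lmeasurable"
    by (intro lmeasurable_open bounded_nbhd_side[OF assms(1)] open_nbhd)
  ultimately show ?thesis
    by (simp add: negligible_iff_measure zero_less_measure_iff)
qed

section \<open>Overlap of the neighbourhoods\<close>

text \<open>The chosen sides lie on lines with coordinates in $\delta(\mathbb{Z}+1/2)$, so at most two lines
  of each direction come within distance less than $\delta$ of a given point.\<close>

lemma card_nbhd_overlap: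
  assumes \<delta>: "0 < \<delta>" and \<rho>: "\<rho> \<in> radius_functions \<delta> z"
    and side: "\<And>c. c \<in> grid_centres \<delta> z \<Longrightarrow> l c \<in> sides c (\<rho> c)"
    and line: "\<And>i a. real (card {c \<in> grid_centres \<delta> z. l c \<subseteq> {y. y$i = a}}) \<le> N"
  shows "real (card {c \<in> grid_centres \<delta> z. y \<in> nbhd \<delta> (l c)}) \<le> 4 * N"
proof -
  define G where "G = grid_centres \<delta> z"
  \<comment> \<open>\<open>m i\<close> is the largest integer whose line
    \<open>\<delta> * (m i + 1/2)\<close> does not exceed \<open>y$i\<close>; only this line and the
    next can be closer than \<open>\<delta>\<close>.\<close>
  define m where "m i = \<lfloor>y$i / \<delta> - 1/2\<rfloor>" for i
  define B where "B = (\<lambda>(i, e). {c \<in> G. l c \<subseteq> {x. x$i = \<delta> * (of_int (m i + e) + 1/2)}})"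
  have "finite G" unfolding G_def using \<delta> by (rule finite_grid_centres)
  have "{c \<in> G. y \<in> nbhd \<delta> (l c)} \<subseteq> (\<Union>j \<in> UNIV \<times> {0, 1}. B j)"
  proof clarify
    fix c assume c: "c \<in> G" "y \<in> nbhd \<delta> (l c)"
    obtain i \<sigma> where l: "l c = {y. y$i = c$i + \<sigma> * \<rho> c \<and> (\<forall>j. \<bar>y$j - c$j\<bar> \<le> \<rho> c)}"
      and \<sigma>: "\<sigma> \<in> {-1, 1}"
      using side[of c] c(1) by (auto simp: sides_def G_def)
    obtain x where x: "x \<in> l c" "dist x y < \<delta>" using c(2) by (auto simp: nbhd_def)
    obtain k :: int where k: "\<rho> c = \<delta> * of_int k"
      using \<rho> c(1) by (auto simp: radius_functions_def G_def PiE_def Pi_def)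
    obtain h :: "int^2" where h: "c = (\<chi> i. \<delta> * (of_int (h$i) + 1/2))"
      using c(1) by (auto simp: G_def grid_centres_def)
    \<comment> \<open>The index of the line carrying the side: centres have half-integer coordinates
      and radii integer ones, in units of \<open>\<delta>\<close>.\<close>
    define n where "n = (if \<sigma> = 1 then h$i + k else h$i - k)"
    have "c$i = \<delta> * (of_int (h$i) + 1/2)" by (simp add: h)
    then have n: "c$i + \<sigma> * \<rho> c = \<delta> * (of_int n + 1/2)"
      unfolding k using \<sigma> by (auto simp: n_def algebra_simps)
    have "\<bar>x$i - y$i\<bar> < \<delta>"
      using dist_vec_nth_le[of x i y] x(2) by (simp add: dist_real_def)
    then have "\<bar>\<delta> * (of_int n + 1/2) - y$i\<bar> < \<delta>" using x(1) by (simp add: l n)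
    then have "\<bar>of_int n + 1/2 - y$i / \<delta>\<bar> < 1" using \<delta> by (simp add: abs_less_iff field_simps)
    \<comment> \<open>Strictness of the bound excludes \<open>m i - 1\<close> when \<open>y\<close>
      lies exactly on a line.\<close>
    then have "n = m i \<or> n = m i + 1" unfolding m_def by linarith
    moreover have "l c \<subseteq> {x. x$i = \<delta> * (of_int n + 1/2)}" by (auto simp: l n)
    ultimately have "c \<in> B (i, 0) \<or> c \<in> B (i, 1)" using c(1) by (auto simp: B_def)
    then show "c \<in> (\<Union>j \<in> UNIV \<times> {0, 1}. B j)" by blast
  qed
  then have "card {c \<in> G. y \<in> nbhd \<delta> (l c)} \<le> card (\<Union>j \<in> UNIV \<times> {0, 1}. B j)"
    using \<open>finite G\<close> by (intro card_mono) (auto simp: B_def)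
  also have "\<dots> \<le> (\<Sum>j \<in> UNIV \<times> {0, 1}. card (B j))"
    by (rule card_UN_le) simp
  finally have "real (card {c \<in> G. y \<in> nbhd \<delta> (l c)}) \<le> (\<Sum>j \<in> UNIV \<times> {0, 1}. real (card (B j)))"
    by (simp flip: of_nat_sum)
  \<comment> \<open>Two directions with two lines each give the factor 4.\<close>
  also have "\<dots> \<le> (\<Sum>j \<in> (UNIV :: 2 set) \<times> {0, 1 :: int}. N)"
    using line by (intro sum_mono) (auto simp: B_def G_def)
  finally show ?thesis by (simp add: G_def card_cartesian_product)
qed

section \<open>The estimate on a single cell\<close>

text \<open>The average is a constant, so the left side is its \<open>p\<close>-th power times the
  \<open>w\<close>-mass of \<open>Q\<close>. After Hoelder, splitting \<open>m powr p\<close> as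
  \<open>m * m powr (p - 1)\<close> distributes the normalisation over the two factors of the weight
  condition. Zero and infinite values are dealt with first.\<close>

lemma average_cell_bound:
  fixes f :: "'a \<Rightarrow> 'b::euclidean_space" and w :: "'a \<Rightarrow> real"
  assumes [measurable]: "f \<in> borel_measurable M" "w \<in> borel_measurable M" "L \<in> sets M" "Q \<in> sets M"
    and p: "1 < p" and w: "\<And>x. 0 \<le> w x" and m: "0 < measure M L"
    and A: "((\<integral>\<^sup>+x\<in>Q. ennreal (w x) \<partial>M) / emeasure M L) *
        epowr ((\<integral>\<^sup>+x\<in>L. epowr (ennreal (w x)) (- (1 / (p - 1))) \<partial>M) / emeasure M L) (p - 1) \<le> A"
    and "A < \<infinity>"
  shows "(\<integral>\<^sup>+x\<in>Q. ennreal (norm ((1 / measure M L) *\<^sub>R (LINT y:L|M. f y)) powr p * w x) \<partial>M)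
    \<le> A * (\<integral>\<^sup>+x\<in>L. ennreal (norm (f x) powr p * w x) \<partial>M)"
proof -
  define m where "m = measure M L"
  define b where "b = norm (LINT y:L|M. f y)"
  define W where "W = (\<integral>\<^sup>+x\<in>Q. ennreal (w x) \<partial>M)"
  define S where "S = (\<integral>\<^sup>+x\<in>L. epowr (ennreal (w x)) (- (1 / (p - 1))) \<partial>M)"
  define F where "F = (\<integral>\<^sup>+x\<in>L. ennreal (norm (f x) powr p * w x) \<partial>M)"
  have m0: "0 < m" using m by (simp add: m_def)
  have emL: "emeasure M L = ennreal m"
    unfolding m_def using m measure_eq_0_null_sets by (metis emeasure_eq_ennreal_measure measure_def enn2real_top less_irrefl)
  have "(\<integral>\<^sup>+x\<in>Q. ennreal (norm ((1 / measure M L) *\<^sub>R (LINT y:L|M. f y)) powr p * w x) \<partial>M)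
      = (\<integral>\<^sup>+x. ennreal ((b / m) powr p) * (ennreal (w x) * indicator Q x) \<partial>M)"
    using w m0 by (intro nn_integral_cong) (simp add: ennreal_mult b_def m_def mult_ac)
  also have "\<dots> = ennreal ((b / m) powr p) * W"
    unfolding W_def by (rule nn_integral_cmult) auto
  also have "\<dots> \<le> A * F"
  \<comment> \<open>In the first case the left side is 0 or the right side is
    \<open>top\<close>.\<close>
  proof (cases "W = 0 \<or> F = \<infinity> \<and> A \<noteq> 0")
    case True
    then show ?thesis by (auto simp: ennreal_mult_top)
  next
    case False
    \<comment> \<open>As \<open>w\<close> is finite everywhere, its negative power vanishes nowhere,
      so its integral over a set of positive measure is nonzero.\<close>
    have "emeasure M {x \<in> space M. epowr (ennreal (w x)) (- (1 / (p - 1))) * indicator L x \<noteq> 0} \<noteq> 0"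
    proof -
      have "epowr (ennreal (w x)) (- (1 / (p - 1))) \<noteq> 0" for x
        using p w[of x] by (auto simp: epowr_def enn2real_eq_0_iff)
      then have "{x \<in> space M. epowr (ennreal (w x)) (- (1 / (p - 1))) * indicator L x \<noteq> 0} = L"
        using sets.sets_into_space[of L M] by (auto simp: indicator_def)
      with emL m0 show ?thesis by simp
    qed
    then have S0: "S \<noteq> 0" unfolding S_def by (subst nn_integral_0_iff) auto
    have *: "(W / ennreal m) * epowr (S / ennreal m) (p - 1) \<le> A"
      using A by (simp add: W_def S_def emL)
    have W0: "W \<noteq> 0" using False by auto
    have pos: "W / ennreal m \<noteq> 0" "S / ennreal m \<noteq> 0"
      using W0 S0 by (auto simp: ennreal_divide_eq_0_iff)
    then have pos': "epowr (S / ennreal m) (p - 1) \<noteq> 0"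
      using p by (auto simp: epowr_def enn2real_eq_0_iff)
    have fin: "(W / ennreal m) * epowr (S / ennreal m) (p - 1) < top"
      using * \<open>A < \<infinity>\<close> by (simp add: le_less_trans)
    \<comment> \<open>Both factors of the weight product are nonzero, so an infinite one would make
      the product infinite, against \<open>A < \<infinity>\<close>.\<close>
    have "S \<noteq> top"
    proof
      assume "S = top"
      with fin pos p m0 show False by (simp add: ennreal_top_divide ennreal_mult_top)
    qed
    moreover have "W \<noteq> top"
    proof
      assume "W = top"
      with fin pos' p m0 show False by (simp add: ennreal_top_divide ennreal_top_mult)
    qed
    \<comment> \<open>The nonzero product bounds \<open>A\<close> from below, so \<open>A\<close> is
      nonzero and the failed case condition leaves \<open>F\<close> finite.\<close>
    moreover have "F \<noteq> top"
      using False * pos pos' by auto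
    ultimately obtain s \<omega> \<phi> where r: "S = ennreal s" "W = ennreal \<omega>" "F = ennreal \<phi>"
        "0 \<le> s" "0 \<le> \<omega>" "0 \<le> \<phi>"
      by (metis ennreal_cases)
    have "0 < s" using r S0 by (cases "s = 0") auto
    have "b powr p \<le> \<phi> * s powr (p - 1)"
      unfolding b_def using r \<open>0 < s\<close> p w by (intro norm_integral_powr_le[where w = w]) (auto simp: S_def F_def)
    then have "(b / m) powr p * \<omega> \<le> \<phi> * s powr (p - 1) / m powr p * \<omega>"
      using r m0 by (simp add: powr_divide b_def divide_right_mono mult_right_mono)
    also have "\<dots> = (\<omega> / m) * (s / m) powr (p - 1) * \<phi>"
      using m0 \<open>0 < s\<close> by (simp add: powr_divide powr_diff mult_ac)
    finally have "ennreal ((b / m) powr p) * W \<le> ennreal ((\<omega> / m) * (s / m) powr (p - 1) * \<phi>)"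
      using r by (simp add: ennreal_leI flip: ennreal_mult)
    also have "\<dots> = (W / ennreal m) * epowr (S / ennreal m) (p - 1) * F"
      using r m0 p by (simp add: divide_ennreal epowr_ennreal flip: ennreal_mult)
    also have "\<dots> \<le> A * F" by (intro mult_right_mono *) auto
    finally show ?thesis .
  qed
  finally show ?thesis by (simp add: F_def)
qed

section \<open>Summation over the cells\<close>

text \<open>The cell estimates share the bound \<open>A_const\<close>, a maximum over cells.
  Exchanging sum and integral turns their sum into an integral against the number of neighbourhoods
  containing a point.\<close>

lemma M_op_integral_bound:
  assumes \<delta>: "0 < \<delta>" "\<delta> < 1" "1 / \<delta> \<in> \<nat>" and \<rho>: "\<rho> \<in> radius_functions \<delta> z"
    and side: "\<And>c. c \<in> grid_centres \<delta> z \<Longrightarrow> l c \<in> sides c (\<rho> c)"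
    and line: "\<And>i a. real (card {c \<in> grid_centres \<delta> z. l c \<subseteq> {y. y$i = a}}) \<le> N"
    and p: "1 < p" "p' = p / (p - 1)" and w: "weight w" and f: "locally_integrable f"
    and A: "A_const \<delta> z l p p' w < \<infinity>"
  shows "(\<integral>\<^sup>+x\<in>unit_square z. ennreal (norm (M_op \<delta> z l f x) powr p * w x) \<partial>lebesgue)
    \<le> ennreal (4 * N) * A_const \<delta> z l p p' w *
        (\<integral>\<^sup>+x\<in>square (unit_centre z) 7. ennreal (norm (f x) powr p * w x) \<partial>lebesgue)"
proof -
  define G where "G = grid_centres \<delta> z"
  define L where "L c = nbhd \<delta> (l c)" for c
  define v where "v c = (1 / measure lebesgue (L c)) *\<^sub>R (LINT y:L c|lebesgue. f y)" for c
  define A where "A = A_const \<delta> z l p p' w"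
  define g where "g x = ennreal (norm (f x) powr p * w x)" for x
  have G: "finite G" using \<delta> by (simp add: G_def finite_grid_centres)
  have w0: "0 \<le> w x" for x using w by (simp add: weight_def)
  have [measurable]: "f \<in> borel_measurable lebesgue" "w \<in> borel_measurable lebesgue"
    using f w by (auto simp: weight_def intro: locally_integrable_measurable)
  have [measurable]: "L c \<in> sets lebesgue" for c
    by (simp add: L_def open_nbhd borel_open)
  have [measurable]: "g \<in> borel_measurable lebesgue" unfolding g_def by measurable
  have r: "1 \<le> \<rho> c" "\<rho> c \<le> 2" if "c \<in> G" for c
    using \<rho> that by (auto simp: radius_functions_def G_def PiE_def Pi_def)
  have cell: "(\<integral>\<^sup>+x\<in>square c \<delta>. ennreal (norm (v c) powr p * w x) \<partial>lebesgue)
      \<le> A * (\<integral>\<^sup>+x\<in>L c. g x \<partial>lebesgue)" if c: "c \<in> G" for c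
    unfolding v_def g_def
  proof (rule average_cell_bound)
    show "0 < measure lebesgue (L c)"
      using measure_nbhd_side_pos[OF side[of c]] c r[OF c] \<delta> by (simp add: L_def G_def)
    have "p' / p = 1 / (p - 1)" using p by simp
    then show "((\<integral>\<^sup>+x\<in>square c \<delta>. ennreal (w x) \<partial>lebesgue) / emeasure lebesgue (L c)) *
        epowr ((\<integral>\<^sup>+x\<in>L c. epowr (ennreal (w x)) (- (1 / (p - 1))) \<partial>lebesgue) / emeasure lebesgue (L c)) (p - 1)
      \<le> A"
      using c G unfolding A_def A_const_def L_def G_def Let_def by (intro Max_ge) auto
  qed (use p w0 A in \<open>auto simp: A_def\<close>)
  \<comment> \<open>Inside the enlarged square the sum counts neighbourhoods through the point;
    outside it no neighbourhood is met.\<close>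
  have overlap: "(\<Sum>c\<in>G. indicator (L c) x) \<le> ennreal (4 * N) * indicator (square (unit_centre z) 7) x" for x
  proof (cases "x \<in> square (unit_centre z) 7")
    case True
    have "(\<Sum>c\<in>G. indicator (L c) x) = (of_nat (card {c \<in> G. x \<in> L c}) :: ennreal)"
      using G by (simp add: indicator_def sum.If_cases Int_def)
    also have "\<dots> = ennreal (real (card {c \<in> G. x \<in> L c}))" by (simp add: ennreal_of_nat_eq_real_of_nat)
    also have "\<dots> \<le> ennreal (4 * N)"
      unfolding G_def L_def by (intro ennreal_leI card_nbhd_overlap[OF \<delta>(1) \<rho> side line])
    finally show ?thesis using True by simp
  next
    case False
    have "x \<notin> L c" if c: "c \<in> G" for c
      using nbhd_subset_square[of c z "\<rho> c" \<delta> "l c"] side[of c] c r[OF c] \<delta> False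
      by (auto simp: G_def grid_centres_def L_def)
    then show ?thesis by (simp add: indicator_def)
  qed
  \<comment> \<open>On the unit square the integrand equals the term of the cell containing the
    point, hence is at most the whole sum.\<close>
  have "(\<integral>\<^sup>+x\<in>unit_square z. ennreal (norm (M_op \<delta> z l f x) powr p * w x) \<partial>lebesgue)
      \<le> (\<integral>\<^sup>+x. (\<Sum>c\<in>G. ennreal (norm (v c) powr p * w x) * indicator (square c \<delta>) x) \<partial>lebesgue)"
  proof (rule nn_integral_mono)
    fix x
    show "ennreal (norm (M_op \<delta> z l f x) powr p * w x) * indicator (unit_square z) x
      \<le> (\<Sum>c\<in>G. ennreal (norm (v c) powr p * w x) * indicator (square c \<delta>) x)"
    proof (cases "x \<in> unit_square z")
      case True
      define c where "c = cell_centre \<delta> z x"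
      have "c \<in> grid_centres \<delta> z \<and> x \<in> square c \<delta>"
        unfolding c_def cell_centre_def by (rule theI'[OF ex1_cell[OF \<delta>(1,3) True]])
      moreover have "M_op \<delta> z l f x = v c" by (simp add: M_op_def v_def L_def c_def Let_def)
      ultimately show ?thesis
        using True G member_le_sum[of c G "\<lambda>c. ennreal (norm (v c) powr p * w x) * indicator (square c \<delta>) x"]
        by (simp add: G_def)
    qed simp
  qed
  also have "\<dots> = (\<Sum>c\<in>G. \<integral>\<^sup>+x\<in>square c \<delta>. ennreal (norm (v c) powr p * w x) \<partial>lebesgue)"
    by (rule nn_integral_sum) measurable
  also have "\<dots> \<le> (\<Sum>c\<in>G. A * (\<integral>\<^sup>+x\<in>L c. g x \<partial>lebesgue))"
    by (intro sum_mono cell)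
  also have "\<dots> = A * (\<integral>\<^sup>+x. (\<Sum>c\<in>G. g x * indicator (L c) x) \<partial>lebesgue)"
    by (simp add: nn_integral_sum sum_distrib_left)
  also have "\<dots> \<le> A * (\<integral>\<^sup>+x. ennreal (4 * N) * (g x * indicator (square (unit_centre z) 7) x) \<partial>lebesgue)"
  proof (intro mult_left_mono nn_integral_mono)
    fix x
    show "(\<Sum>c\<in>G. g x * indicator (L c) x) \<le> ennreal (4 * N) * (g x * indicator (square (unit_centre z) 7) x)"
      using mult_left_mono[OF overlap[of x], of "g x"] by (simp add: sum_distrib_left mult_ac)
  qed simp
  also have "\<dots> = ennreal (4 * N) * A * (\<integral>\<^sup>+x\<in>square (unit_centre z) 7. g x \<partial>lebesgue)"
    by (subst nn_integral_cmult) (auto simp: mult_ac)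
  finally show ?thesis by (simp add: A_def g_def)
qed

theorem theorem1p11:
  fixes C0 :: real
  shows "\<exists>C>0. \<forall>(\<delta>::real) \<Phi> (z::int^2) \<rho> (p::real) (p'::real) w f.
    0 < \<delta> \<and> \<delta> < 1 \<and> 1/\<delta> \<in> \<nat> \<longrightarrow>
    admissible_selection C0 \<delta> \<Phi> \<longrightarrow>
    \<rho> \<in> radius_functions \<delta> z \<longrightarrow>
    1 < p \<and> p' \<in> \<nat> \<and> 1/p + 1/p' = 1 \<longrightarrow>
    weight w \<longrightarrow>
    A_const \<delta> z (\<Phi> z \<rho>) p p' w < \<infinity> \<longrightarrow>
    locally_integrable f \<longrightarrow>
    Lp_norm p (unit_square z) w (M_op \<delta> z (\<Phi> z \<rho>) f)
      \<le> ennreal (C * \<delta> powr (- (5 / (4*p)))) * epowr (A_const \<delta> z (\<Phi> z \<rho>) p p' w) (1/p)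
          * Lp_norm p (square (unit_centre z) 7) w f"
\<comment> \<open>The maximum with 1 makes the constant positive and lets its \<open>p\<close>-th
  root be bounded by itself; it depends on \<open>C0\<close> alone.\<close>
proof (intro exI[of _ "max 1 (4 * C0)"] conjI allI impI)
  show "0 < max 1 (4 * C0)" by simp
next
  fix \<delta> \<Phi> z \<rho> p p' w and f :: "real^2 \<Rightarrow> complex"
  assume \<delta>: "0 < \<delta> \<and> \<delta> < 1 \<and> 1/\<delta> \<in> \<nat>"
    and \<Phi>: "admissible_selection C0 \<delta> \<Phi>"
    and \<rho>: "\<rho> \<in> radius_functions \<delta> z"
    and p: "1 < p \<and> p' \<in> \<nat> \<and> 1/p + 1/p' = 1"
    and w: "weight w" and A: "A_const \<delta> z (\<Phi> z \<rho>) p p' w < \<infinity>" and f: "locally_integrable f"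
  define C where "C = max 1 (4 * C0)"
  have C: "1 \<le> C" "4 * C0 \<le> C" by (auto simp: C_def)
  let ?A = "A_const \<delta> z (\<Phi> z \<rho>) p p' w"
  let ?F = "\<integral>\<^sup>+x\<in>square (unit_centre z) 7. ennreal (norm (f x) powr p * w x) \<partial>lebesgue"
  \<comment> \<open>Taking the \<open>p\<close>-th root of this power yields the exponent
    \<open>- (5 / (4*p))\<close>.\<close>
  have u: "(1/\<delta>\<^sup>2) powr (5/8) = \<delta> powr (-5/4)"
  proof -
    have "1/\<delta>\<^sup>2 = \<delta> powr (-2)" using \<delta> by (simp add: powr_minus divide_inverse)
    then show ?thesis by (simp add: powr_powr)
  qed
  have p': "p' = p / (p - 1)"
  proof -
    have "1/p' = (p - 1) / p" using p by (simp add: diff_divide_distrib)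
    moreover have "p' = 1 / (1/p')" by simp
    ultimately show ?thesis by simp
  qed
  have "(\<integral>\<^sup>+x\<in>unit_square z. ennreal (norm (M_op \<delta> z (\<Phi> z \<rho>) f x) powr p * w x) \<partial>lebesgue)
      \<le> ennreal (4 * (C0 * (1/\<delta>\<^sup>2) powr (5/8))) * ?A * ?F"
    using \<delta> \<Phi> \<rho> p p' w A f
    by (intro M_op_integral_bound[where \<rho> = \<rho>]) (auto simp: admissible_selection_def)
  also have "\<dots> \<le> ennreal (C * \<delta> powr (-5/4)) * ?A * ?F"
    using C by (intro mult_right_mono ennreal_leI) (auto simp: u intro!: mult_right_mono[of "4 * C0", unfolded mult.assoc])
  finally have "Lp_norm p (unit_square z) w (M_op \<delta> z (\<Phi> z \<rho>) f)
      \<le> epowr (ennreal (C * \<delta> powr (-5/4)) * ?A * ?F) (1/p)"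
    unfolding Lp_norm_def using p by (intro epowr_mono) auto
  also have "\<dots> = epowr (ennreal (C * \<delta> powr (-5/4))) (1/p) * epowr ?A (1/p)
      * Lp_norm p (square (unit_centre z) 7) w f"
    unfolding Lp_norm_def using p by (simp add: epowr_mult)
  also have "epowr (ennreal (C * \<delta> powr (-5/4))) (1/p) = ennreal (C powr (1/p) * \<delta> powr (- (5 / (4*p))))"
    using C p by (simp add: epowr_ennreal powr_mult powr_powr)
  \<comment> \<open>\<open>C powr (1/p) \<le> C\<close> since \<open>1 \<le> C\<close> and
    \<open>1/p < 1\<close>, which makes the constant independent of \<open>p\<close>.\<close>
  also have "\<dots> \<le> ennreal (C * \<delta> powr (- (5 / (4*p))))"
    using powr_mono[of "1/p" 1 C] C p by (intro ennreal_leI mult_right_mono) auto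
  finally show "Lp_norm p (unit_square z) w (M_op \<delta> z (\<Phi> z \<rho>) f)
      \<le> ennreal (max 1 (4 * C0) * \<delta> powr (- (5 / (4*p)))) * epowr ?A (1/p)
          * Lp_norm p (square (unit_centre z) 7) w f"
    by (simp add: C_def mult_right_mono)
qed

end
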